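(* Let $e \ge 2$, let $2 \le g_1 < \ldots < g_e$ be integers with $\gcd(g_1,\ldots,g_e)=1$, let $S=\langle g_1,\ldots,g_e \rangle$, and suppose that $\{g_1,\ldots,g_e\}$ is the minimal generating system of $S$. Let $F=\max(\mathbb{Z}\setminus S)$, $n=|S\cap[0,F]|$, let $t$ be the type of $S$, and let $q=\left\lceil \frac{F+1}{g_1}\right\rceil \ge 1$. Then $$t \le (e-2)(n-q+1)+2 \le (e-2)n+2.$$
   Context: $\mathbb{N}$ denotes the set of non-negative integers. For $g_1,\ldots,g_e\in\mathbb{N}$ with $\gcd(g_1,\ldots,g_e)=1$, $\langle g_1,\ldots,g_e\rangle=\{a_1g_1+\ldots+a_eg_e \mid a_i\in\mathbb{N}\}$; it is a submonoid of $(\mathbb{N},+)$ with finite complement in $\mathbb{N}$, called a numerical semigroup. Every numerical semigroup has a unique minimal generating system (a generating set no proper subset of which generates $S$), and its cardinality $e$ is the embedding dimension of $S$. $F$ is the Frobenius number of $S$, and $n$ is the number of elements of $S$ less than $F$. The set of pseudo-Frobenius numbers of $S$ is $PF(S)=\{\omega\in\mathbb{Z}\setminus S \mid \omega+s\in S \text{ for every } s\in S\setminus\{0\}\}$, and the type of $S$ is $t=|PF(S)|$. *)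

theory Defs
  imports Complex_Main
begin

(* Intended for finite A only: for infinite A the sum, and hence the set, degenerates to 0. *)
definition generated :: "nat set \<Rightarrow> nat set" where
  "generated A = {\<Sum>x\<in>A. a x * x | a :: nat \<Rightarrow> nat. True}"

definition minimal_generating_system :: "nat set \<Rightarrow> nat set \<Rightarrow> bool" where
  "minimal_generating_system A S \<longleftrightarrow>
     finite A \<and> generated A = S \<and> (\<forall>B. B \<subset> A \<longrightarrow> generated B \<noteq> S)"

(* The maximum of the complement in the integers (which contains all negative integers, so Max,
   which is for finite sets, does not apply). For a numerical semigroup the maximum exists. *)
definition frobenius_number :: "nat set \<Rightarrow> int" where
  "frobenius_number S = (GREATEST x. x \<notin> int ` S)"

definition pseudo_frobenius :: "nat set \<Rightarrow> int set" where
  "pseudo_frobenius S =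
     {\<omega>. \<omega> \<notin> int ` S \<and> (\<forall>s \<in> S - {0}. \<omega> + int s \<in> int ` S)}"

(* The pseudo-Frobenius numbers of a numerical semigroup form a finite set, so card is the
   true cardinality. *)
definition semigroup_type :: "nat set \<Rightarrow> nat" where
  "semigroup_type S = card (pseudo_frobenius S)"

end

theory Submission
  imports Defs
begin

text \<open>
  The bound counts pseudo-Frobenius numbers by looking at \<open>f + g\<^sub>1\<close>, which lies in \<open>S\<close> for
  every pseudo-Frobenius number \<open>f\<close>. Write it as a combination of the generators.

  If some \<open>g\<^sub>i\<close> with \<open>i \<ge> 3\<close> occurs, then \<open>f + g\<^sub>1 = g\<^sub>i + s\<close> with \<open>s \<in> S\<close>. Here \<open>s \<le> f \<le> F\<close>
  because \<open>g\<^sub>1 \<le> g\<^sub>i\<close>, and \<open>s - g\<^sub>1 \<notin> S\<close> because otherwise \<open>f \<in> S\<close>; so \<open>s\<close> is a small element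
  of the Apery set of \<open>S\<close> with respect to \<open>g\<^sub>1\<close>. The pair \<open>(g\<^sub>i, s)\<close> determines \<open>f\<close>. The multiples
  \<open>g\<^sub>1, 2 g\<^sub>1, \<dots>, (q - 1) g\<^sub>1\<close> are elements of \<open>S \<inter> [0, F]\<close> outside the Apery set, so there are at
  most \<open>n - q + 1\<close> choices for \<open>s\<close>, and hence at most \<open>(e - 2) (n - q + 1)\<close> such \<open>f\<close>.

  Otherwise \<open>f + g\<^sub>1\<close> is a combination of \<open>g\<^sub>1\<close> and \<open>g\<^sub>2\<close>, and \<open>g\<^sub>1\<close> cannot occur since \<open>f \<notin> S\<close>;
  so \<open>f + g\<^sub>1\<close> is a multiple of \<open>g\<^sub>2\<close>. Two pseudo-Frobenius numbers never differ by a nonzero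
  element of \<open>S\<close>, which leaves room for only one such \<open>f\<close>.

  The two counts are combined in \<open>semigroup_type_le\<close> and \<open>card_small_apery_le\<close>; they give the
  constant \<open>1\<close> where the theorem has \<open>2\<close>. That \<open>F\<close> bounds all gaps rests on the finiteness of
  the complement, proved in \<open>submonoid_gcd_1_cofinite\<close>.
\<close>

section \<open>Combinations of generators\<close>

lemma zero_in_generated: "0 \<in> generated A"
  unfolding generated_def by (auto intro: exI[of _ "\<lambda>_. 0"])

lemma add_in_generated:
  assumes "x \<in> generated A" "y \<in> generated A"
  shows "x + y \<in> generated A"
proof -
  obtain a b where "x = (\<Sum>z\<in>A. a z * z)" "y = (\<Sum>z\<in>A. b z * z)"
    using assms unfolding generated_def by blast
  then have "x + y = (\<Sum>z\<in>A. (a z + b z) * z)"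
    by (simp add: sum.distrib algebra_simps)
  then show ?thesis unfolding generated_def by (auto intro: exI[of _ "\<lambda>z. a z + b z"])
qed

lemma generator_in_generated:
  assumes "finite A" "x \<in> A"
  shows "x \<in> generated A"
proof -
  have "(\<Sum>z\<in>A. (if z = x then 1 else 0) * z) = x"
    using assms by (simp add: if_distrib[of "\<lambda>c. c * _"] sum.delta cong: if_cong)
  then show ?thesis unfolding generated_def
    by (auto intro!: exI[of _ "\<lambda>z. if z = x then 1 else 0"])
qed

lemma mult_in_generated: "x \<in> generated A \<Longrightarrow> c * x \<in> generated A"
  by (induction c) (auto intro: zero_in_generated add_in_generated)

lemma positive_in_generated_ge:
  assumes "finite A" "\<And>x. x \<in> A \<Longrightarrow> m \<le> x" "s \<in> generated A" "s > 0"
  shows "m \<le> s"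
proof -
  obtain a where s: "s = (\<Sum>z\<in>A. a z * z)"
    using assms(3) unfolding generated_def by blast
  have "\<exists>x\<in>A. a x * x \<noteq> 0"
  proof (rule ccontr)
    assume "\<not> ?thesis"
    then have "s = 0" unfolding s by (intro sum.neutral) blast
    then show False using \<open>s > 0\<close> by simp
  qed
  then obtain x where x: "x \<in> A" "a x * x \<noteq> 0" by blast
  have "m \<le> x" using x(1) by (rule assms(2))
  also have "x \<le> a x * x" using x(2) by simp
  also have "\<dots> \<le> s"
    unfolding s using assms(1) x(1) by (intro member_le_sum) auto
  finally show ?thesis .
qed

text \<open>A combination either uses a generator outside \<open>B\<close>, one copy of which can be split off, or it
  has coefficients supported on \<open>B\<close>.\<close>

lemma generated_split:
  assumes "finite A" "B \<subseteq> A" "w \<in> generated A"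
  shows "(\<exists>x\<in>A - B. \<exists>s\<in>generated A. w = x + s) \<or> w \<in> generated B"
proof -
  obtain a where w: "w = (\<Sum>z\<in>A. a z * z)"
    using assms(3) unfolding generated_def by blast
  show ?thesis
  proof (cases "\<exists>x\<in>A - B. a x > 0")
    case True
    then obtain x where x: "x \<in> A - B" "a x > 0" by blast
    let ?b = "a(x := a x - 1)"
    have "(\<Sum>z\<in>A. ?b z * z) = (a x - 1) * x + (\<Sum>z\<in>A - {x}. a z * z)"
      using assms(1) x(1) by (subst sum.remove[of A x]) (auto intro: sum.cong)
    moreover have "w = a x * x + (\<Sum>z\<in>A - {x}. a z * z)"
      unfolding w using assms(1) x(1) by (subst sum.remove[of A x]) auto
    moreover have "a x * x = x + (a x - 1) * x"
      using x(2) by (cases "a x") auto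
    ultimately have "w = x + (\<Sum>z\<in>A. ?b z * z)" by simp
    then show ?thesis using x(1) unfolding generated_def by blast
  next
    case False
    then have "w = (\<Sum>z\<in>B. a z * z)"
      unfolding w using assms by (intro sum.mono_neutral_right) auto
    then show ?thesis unfolding generated_def by blast
  qed
qed

lemma generated_pairD:
  assumes "w \<in> generated {m, k}"
  shows "\<exists>a b. w = a * m + b * k"
proof -
  obtain a where w: "w = (\<Sum>z\<in>{m, k}. a z * z)"
    using assms unfolding generated_def by blast
  show ?thesis
  proof (cases "m = k")
    case True
    then have "w = a m * m + 0 * k" using w by simp
    then show ?thesis by blast
  next
    case False
    then have "w = a m * m + a k * k" using w by simp
    then show ?thesis by blast
  qed
qed

section \<open>Finiteness of the complement\<close>

text \<open>The least positive difference \<open>d\<close> of two elements of \<open>S\<close> divides every element, since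
  otherwise a remainder modulo \<open>d\<close> would be a smaller positive difference. Hence \<open>d = 1\<close>,
  that is, \<open>S\<close> contains two consecutive numbers \<open>u\<close> and \<open>u + 1\<close>; writing \<open>x = c u + r\<close> with
  \<open>r < u \<le> c\<close> (if \<open>u > 0\<close>; otherwise \<open>1 \<in> S\<close>) shows that all \<open>x \<ge> u\<^sup>2\<close> are of the form \<open>(c - r) u + r (u + 1)\<close>.\<close>

lemma submonoid_gcd_1_cofinite:
  fixes S :: "nat set"
  assumes zero: "0 \<in> S" and add: "\<And>x y. x \<in> S \<Longrightarrow> y \<in> S \<Longrightarrow> x + y \<in> S"
    and gcd: "Gcd S = 1"
  shows "\<exists>N. \<forall>x\<ge>N. x \<in> S"
proof -
  have mult: "c * x \<in> S" if "x \<in> S" for c x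
    by (induction c) (use that zero add in auto)
  define P where "P d \<longleftrightarrow> d > 0 \<and> (\<exists>u\<in>S. u + d \<in> S)" for d
  have "\<exists>x\<in>S. x > 0"
  proof (rule ccontr)
    assume "\<not> ?thesis"
    then have "Gcd S = 0" by auto
    with gcd show False by simp
  qed
  then obtain x where "x \<in> S" "x > 0" by blast
  then have "P x" unfolding P_def using bexI[OF _ zero, of "\<lambda>u. u + x \<in> S"] by simp
  define d where "d = (LEAST d. P d)"
  have "P d" unfolding d_def using \<open>P x\<close> by (rule LeastI)
  then obtain u where d: "d > 0" and u: "u \<in> S" "u + d \<in> S" unfolding P_def by blast
  have "d dvd x" if x: "x \<in> S" for x
  proof (rule ccontr)
    assume "\<not> d dvd x"
    then have "x mod d > 0" by (simp add: dvd_eq_mod_eq_0)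
    let ?c = "x div d"
    \<comment> \<open>The difference of \<open>x + c u\<close> and \<open>c (u + d)\<close> is the remainder \<open>x mod d\<close>.\<close>
    have "?c * (u + d) + x mod d = x + ?c * u" by (simp add: algebra_simps)
    then have "?c * (u + d) + x mod d \<in> S" using add[OF x mult[OF u(1), of ?c]] by simp
    then have "P (x mod d)"
      unfolding P_def using \<open>x mod d > 0\<close> mult[OF u(2), of ?c] by blast
    then have "d \<le> x mod d" unfolding d_def by (rule Least_le)
    then show False using mod_less_divisor[OF d, of x] by linarith
  qed
  then have "d dvd Gcd S" by (rule Gcd_greatest)
  then have "d = 1" using gcd by simp
  then have u1: "u + 1 \<in> S" using u by simp
  have "x \<in> S" if "x \<ge> u * u" for x
  proof (cases "u = 0")
    case True
    then show ?thesis using mult[OF u1, of x] by simp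
  next
    case False
    let ?c = "x div u" and ?r = "x mod u"
    have "u \<le> ?c" using that False by (simp add: less_eq_div_iff_mult_less_eq)
    moreover have "?r < u" using False by simp
    ultimately have le: "?r \<le> ?c" by linarith
    have "(?c - ?r) * u + ?r * (u + 1) = ((?c - ?r) + ?r) * u + ?r"
      unfolding distrib_right by simp
    also have "\<dots> = x" using le by simp
    finally show ?thesis using add[OF mult[OF u(1)] mult[OF u1]] by metis
  qed
  then show ?thesis by blast
qed

lemma frobenius_number_props:
  assumes "\<forall>x\<ge>N. x \<in> S"
  shows "frobenius_number S \<notin> int ` S"
    and "x \<notin> int ` S \<Longrightarrow> x \<le> frobenius_number S"
proof -
  \<comment> \<open>The value \<open>-1\<close> makes the set of candidates nonempty even if \<open>S\<close> is all of the naturals.\<close>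
  define G where "G = {x. x \<notin> int ` S \<and> x \<ge> -1}"
  have small: "x < int N" if "x \<notin> int ` S" for x
  proof (rule ccontr)
    assume "\<not> x < int N"
    then have "nat x \<in> S" "x = int (nat x)" using assms by auto
    then show False using that by blast
  qed
  have "G \<subseteq> {-1..int N}" unfolding G_def using small by force
  then have fin: "finite G" by (rule finite_subset) simp
  have m1: "-1 \<in> G" unfolding G_def by auto
  then have M: "Max G \<in> G" using Max_in[OF fin] by blast
  have up: "y \<le> Max G" if "y \<notin> int ` S" for y
  proof (cases "y \<ge> -1")
    case True
    then show ?thesis using that fin unfolding G_def by (intro Max_ge) (auto simp: G_def)
  next
    case False
    then show ?thesis using Max_ge[OF fin m1] by linarith
  qed
  have M_gap: "Max G \<notin> int ` S" using M unfolding G_def by blast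
  have eq: "frobenius_number S = Max G"
    unfolding frobenius_number_def
    by (rule Greatest_equality) (use M_gap up in auto)
  show "frobenius_number S \<notin> int ` S"
    and "x \<notin> int ` S \<Longrightarrow> x \<le> frobenius_number S"
    unfolding eq by (fact M_gap, fact up)
qed

section \<open>Counting pseudo-Frobenius numbers\<close>

text \<open>The Apery set consists of the \<open>s \<in> S\<close> with \<open>s - m \<notin> S\<close>. The last conjunct says this without
  the truncated subtraction, which would exclude \<open>s = 0\<close>.\<close>

definition small_apery :: "nat set \<Rightarrow> nat \<Rightarrow> int \<Rightarrow> nat set" where
  "small_apery S m F = {s \<in> S. int s \<le> F \<and> (\<forall>s'\<in>S. s \<noteq> s' + m)}"

lemma finite_small_apery: "finite (small_apery S m F)"
proof (rule finite_subset)
  show "small_apery S m F \<subseteq> {..nat F}" unfolding small_apery_def by auto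
qed simp

text \<open>Positive multiples \<open>j m\<close> are excluded from the Apery set because \<open>(j - 1) m \<in> S\<close>.\<close>

lemma card_small_apery_le:
  fixes r :: nat
  assumes "m > 0" "\<And>c. c * m \<in> S" "int (r * m) \<le> F"
  shows "card (small_apery S m F) + r \<le> card (int ` S \<inter> {0..F})"
proof -
  let ?W = "small_apery S m F" and ?M = "(\<lambda>j. j * m) ` {1..r}"
  have M_S: "j * m \<in> S" for j using assms(2) .
  have disj: "?W \<inter> ?M = {}"
  proof -
    have "j * m \<notin> ?W" if "j \<in> {1..r}" for j
    proof -
      have "j * m = (j - 1) * m + m" using that by (cases j) auto
      then show ?thesis unfolding small_apery_def using M_S[of "j - 1"] by auto
    qed
    then show ?thesis by blast
  qed
  have "card ?M = r"
    using assms(1) by (subst card_image) (auto simp: inj_on_def)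
  then have "card ?W + r = card (?W \<union> ?M)"
    using disj by (simp add: card_Un_disjoint finite_small_apery)
  also have "\<dots> = card (int ` (?W \<union> ?M))"
    by (rule card_image[symmetric]) (simp add: inj_on_def)
  also have "\<dots> \<le> card (int ` S \<inter> {0..F})"
  proof (rule card_mono)
    have "int (j * m) \<le> F" if "j \<le> r" for j
      using assms(3) that by (meson mult_le_mono1 of_nat_mono order_trans)
    then show "int ` (?W \<union> ?M) \<subseteq> int ` S \<inter> {0..F}"
      using M_S by (fastforce simp: small_apery_def simp del: of_nat_mult)
  qed simp
  finally show ?thesis .
qed

lemma pseudo_frobenius_diff_notin:
  assumes "f \<in> pseudo_frobenius S" "f' \<in> pseudo_frobenius S" "s \<in> S" "f' = f + int s"
  shows "s = 0"
  using assms unfolding pseudo_frobenius_def by auto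

text \<open>The generator \<open>k\<close> plays a special part: pseudo-Frobenius numbers \<open>f\<close> for which \<open>f + m\<close>
  uses only \<open>m\<close> and \<open>k\<close> form a chain under differences in \<open>S\<close>, so they contribute \<open>1\<close> in total
  and not one for each element of the Apery set.\<close>

lemma semigroup_type_le:
  fixes A :: "nat set" and m k :: nat
  defines "S \<equiv> generated A"
  assumes fin: "finite A" and mk: "m \<in> A" "k \<in> A" and m0: "m > 0"
    and min: "\<And>x. x \<in> A \<Longrightarrow> m \<le> x"
    and F: "\<And>x. x \<notin> int ` S \<Longrightarrow> x \<le> F"
  shows "semigroup_type S \<le> card (A - {m, k}) * card (small_apery S m F) + 1"
proof -
  let ?R = "A - {m, k}" and ?W = "small_apery S m F"
  define P where "P = pseudo_frobenius S \<inter> range (\<lambda>b. int (b * k) - int m)"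
  have mS: "m \<in> S" and kS: "b * k \<in> S" for b
    using fin mk unfolding S_def by (auto intro: generator_in_generated mult_in_generated)
  have add: "x + y \<in> S" if "x \<in> S" "y \<in> S" for x y
    using that unfolding S_def by (rule add_in_generated)
  have cover: "pseudo_frobenius S \<subseteq> (\<lambda>(x, s). int (x + s) - int m) ` (?R \<times> ?W) \<union> P"
  proof
    fix f assume f: "f \<in> pseudo_frobenius S"
    then have fS: "f \<notin> int ` S" and "f + int m \<in> int ` S"
      using mS m0 unfolding pseudo_frobenius_def by auto
    then obtain w where w: "w \<in> S" "f + int m = int w" by blast
    from generated_split[OF fin, of "{m, k}" w] w(1) mk
    consider x s where "x \<in> ?R" "s \<in> S" "w = x + s" | "w \<in> generated {m, k}"
      unfolding S_def by auto
    then show "f \<in> (\<lambda>(x, s). int (x + s) - int m) ` (?R \<times> ?W) \<union> P"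
    proof cases
      case 1
      have "int s \<le> F"
        using F[OF fS] w(2) 1(3) min[of x] 1(1) by simp
      moreover have "s \<noteq> s' + m" if "s' \<in> S" for s'
      proof
        assume "s = s' + m"
        then have "f = int (x + s')" using w(2) 1(3) by simp
        moreover have "x + s' \<in> S"
          using add[OF _ that] 1(1) fin generator_in_generated unfolding S_def by blast
        ultimately show False using fS by blast
      qed
      ultimately have "s \<in> ?W" using 1(2) unfolding small_apery_def by blast
      moreover have "f = int (x + s) - int m" using w(2) 1(3) by simp
      ultimately show ?thesis using 1(1) by force
    next
      case 2
      then obtain a b where ab: "w = a * m + b * k" using generated_pairD by blast
      have "a = 0"
      proof (rule ccontr)
        assume "a \<noteq> 0"
        then have "w = ((a - 1) * m + b * k) + m" using ab by (cases a) auto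
        then have "f = int ((a - 1) * m + b * k)" using w(2) by simp
        moreover have "(a - 1) * m + b * k \<in> S"
          using add[OF _ kS] mS mult_in_generated unfolding S_def by blast
        ultimately show False using fS by blast
      qed
      then have "f = int (b * k) - int m" using ab w(2) by simp
      then show ?thesis using f unfolding P_def by blast
    qed
  qed
  have P_le: "b * k = c * k"
    if "int (b * k) - int m \<in> P" "int (c * k) - int m \<in> P" "b \<le> c" for b c
  proof -
    have "c * k = b * k + (c - b) * k"
      using that(3) by (metis add_mult_distrib le_add_diff_inverse)
    then have "int (c * k) - int m = (int (b * k) - int m) + int ((c - b) * k)"
      by simp
    from pseudo_frobenius_diff_notin[OF _ _ kS this] that(1,2)
    have "(c - b) * k = 0" unfolding P_def by blast
    with \<open>c * k = b * k + (c - b) * k\<close> show ?thesis by (metis add_0_right)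
  qed
  have P_eq: "y = z" if yz: "y \<in> P" "z \<in> P" for y z
  proof -
    obtain b c where "y = int (b * k) - int m" "z = int (c * k) - int m"
      using yz unfolding P_def by blast
    then show ?thesis using P_le[of b c] P_le[of c b] yz by (metis nat_le_linear)
  qed
  have "P = {} \<or> (\<exists>y. P = {y})" using P_eq by blast
  then have P1: "finite P" "card P \<le> 1" by auto
  have finRW: "finite (?R \<times> ?W)" using fin finite_small_apery by blast
  have "semigroup_type S \<le> card ((\<lambda>(x, s). int (x + s) - int m) ` (?R \<times> ?W) \<union> P)"
    unfolding semigroup_type_def by (rule card_mono) (use cover finRW P1 in auto)
  also have "\<dots> \<le> card ((\<lambda>(x, s). int (x + s) - int m) ` (?R \<times> ?W)) + card P"
    by (rule card_Un_le)
  also have "\<dots> \<le> card (?R \<times> ?W) + 1"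
    using card_image_le[OF finRW] P1(2) by (intro add_mono) auto
  finally show ?thesis by (simp add: card_cartesian_product)
qed

theorem theorem3:
  fixes e n t :: nat and g :: "nat \<Rightarrow> nat" and S :: "nat set" and F q :: int
  assumes "e \<ge> 2"
    and "g 1 \<ge> 2"
    and "strict_mono_on {1..e} g"
    and "Gcd (g ` {1..e}) = 1"
    and "S = generated (g ` {1..e})"
    and "minimal_generating_system (g ` {1..e}) S"
    and "F = frobenius_number S"
    and "n = card (int ` S \<inter> {0..F})"
    and "t = semigroup_type S"
    and "q = \<lceil>real_of_int (F + 1) / real (g 1)\<rceil>"
  shows "q \<ge> 1
    \<and> int t \<le> (int e - 2) * (int n - q + 1) + 2
    \<and> (int e - 2) * (int n - q + 1) + 2 \<le> (int e - 2) * int n + 2"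
proof -
  let ?A = "g ` {1..e}" and ?W = "small_apery S (g 1) F"
  note S = assms(5)
  have fin: "finite ?A" by simp
  have inj: "inj_on g {1..e}" using assms(3) by (rule strict_mono_on_imp_inj_on)
  have in_A: "g 1 \<in> ?A" "g 2 \<in> ?A" using assms(1) by auto
  have min: "g 1 \<le> x" if "x \<in> ?A" for x
    using that assms(1) strict_mono_on_leD[OF assms(3)] by auto
  have "Gcd S dvd x" if "x \<in> ?A" for x
    using that generator_in_generated[OF fin] unfolding S by (intro Gcd_dvd) auto
  then have "Gcd S dvd Gcd ?A" by (rule Gcd_greatest)
  then have "Gcd S = 1" using assms(4) by simp
  then obtain N where N: "\<forall>x\<ge>N. x \<in> S"
    using submonoid_gcd_1_cofinite[of S] zero_in_generated add_in_generated unfolding S by blast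
  have le_F: "x \<le> F" if "x \<notin> int ` S" for x
    unfolding assms(7) using frobenius_number_props(2)[OF N] that .
  have "1 \<notin> S"
    using positive_in_generated_ge[OF fin min, of 1] assms(2) unfolding S by auto
  then have "1 \<notin> int ` S" by (metis image_iff of_nat_eq_1_iff)
  then have F1: "F \<ge> 1" by (rule le_F)
  have g1: "real (g 1) > 0" using assms(2) by simp
  then have "real_of_int (F + 1) / real (g 1) > 0" using F1 by (intro divide_pos_pos) auto
  then have q1: "q \<ge> 1" unfolding assms(10) by linarith
  \<comment> \<open>The largest multiple of \<open>g 1\<close> in \<open>[0, F]\<close> is \<open>r * g 1\<close>.\<close>
  define r where "r = nat (q - 1)"
  have qr: "q = int r + 1" using q1 unfolding r_def by simp
  have "real r < real_of_int (F + 1) / real (g 1)"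
    using assms(10) qr by linarith
  then have "real r * real (g 1) < real_of_int (F + 1)" using g1 by (simp add: field_simps)
  then have "real_of_int (int (r * g 1)) < real_of_int (F + 1)" by simp
  then have "int (r * g 1) \<le> F" unfolding of_int_less_iff by simp
  moreover have "c * g 1 \<in> S" for c
    unfolding S using generator_in_generated[OF fin in_A(1)] by (rule mult_in_generated)
  ultimately have W: "card ?W + r \<le> n"
    unfolding assms(8) using card_small_apery_le[of "g 1" S r F] assms(2) by auto

  have "g 1 \<noteq> g 2" using strict_mono_onD[OF assms(3), of 1 2] assms(1) by simp
  then have "card (?A - {g 1, g 2}) = e - 2"
    using in_A card_image[OF inj] by (subst card_Diff_subset) auto
  then have "t \<le> (e - 2) * card ?W + 1"
    using semigroup_type_le[OF fin in_A _ min, of F] le_F assms(2) unfolding assms(9) S by auto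
  also have "\<dots> \<le> (e - 2) * (n - r) + 1"
    using W by (intro add_mono mult_le_mono2) auto
  finally have "int t \<le> int ((e - 2) * (n - r) + 1)" by (rule of_nat_mono)
  also have "\<dots> = (int e - 2) * (int n - q + 1) + 1"
    using W assms(1) qr by (simp add: of_nat_diff)
  finally have "int t \<le> (int e - 2) * (int n - q + 1) + 2" by simp
  moreover have "(int e - 2) * (int n - q + 1) \<le> (int e - 2) * int n"
    using assms(1) q1 by (intro mult_left_mono) auto
  ultimately show ?thesis using q1 by simp
qed

end
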